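(* Let $\alpha\le 0$ and $\beta>0$ be real numbers, and let $f\in\mathcal{A}$ satisfy $f(z)f'(z)/z\neq 0$ for all $z\in\mathbb{D}$. If at least one of the following inequalities holds for all $z\in\mathbb{D}$: (i) $\operatorname{Re}\left(\alpha\dfrac{Q_{SD}}{Q_{ST}}+\beta Q_{ST}Q_{CV}\right)>-\dfrac{\beta}{2}$; (ii) $\operatorname{Re}\left(\alpha\dfrac{Q_{SD}}{Q_{CV}}+\beta Q_{ST}Q_{CV}\right)>-\dfrac{\beta}{2}$; (iii) $\operatorname{Re}\left(\alpha\dfrac{Q_{SD}}{Q_{CV}}+\beta Q_{ST}Q_{ST}\right)>0$; (iv) $\operatorname{Re}\left(\alpha\dfrac{Q_{SD}}{Q_{ST}}+\beta Q_{CV}Q_{CV}\right)>0$; (v) $\operatorname{Re}\left(\alpha\dfrac{Q_{SD}}{Q_{ST}}+\beta Q_{ST}Q_{ST}\right)>0$; (vi) $\operatorname{Re}\left(\alpha\dfrac{Q_{SD}}{Q_{CV}}+\beta Q_{CV}Q_{CV}\right)>0$; then $f$ is starlike.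
   Context: $\mathbb{D}=\{z\in\mathbb{C}:|z|<1\}$. $\mathcal{A}$ is the class of analytic functions $f:\mathbb{D}\to\mathbb{C}$ with $f(0)=0$ and $f'(0)=1$. For $f\in\mathcal{A}$, as functions of $z\in\mathbb{D}$: $Q_{ST}=zf'(z)/f(z)$ (with the removable singularity at $z=0$ filled in, value $1$), $Q_{CV}=1+zf''(z)/f'(z)$, and $Q_{SD}=z^2\Big(\big(f''(z)/f'(z)\big)'-\tfrac12\big(f''(z)/f'(z)\big)^2\Big)$ ($z^2$ times the Schwarzian derivative of $f$). The condition $f(z)f'(z)/z\neq0$ is understood at $z=0$ via the removable singularity (where the value is $1$). An inequality containing a quotient is understood to include the requirement that the denominators appearing in it do not vanish in $\mathbb{D}$. A function $f\in\mathcal{A}$ is starlike if $\operatorname{Re}Q_{ST}>0$ on $\mathbb{D}$; equivalently, $f$ is univalent and $tf(z)\in f(\mathbb{D})$ for all $z\in\mathbb{D}$, $t\in[0,1]$. *)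

theory Defs
  imports "HOL-Complex_Analysis.Complex_Analysis"
begin

abbreviation unit_disc :: "complex set" where
  "unit_disc \<equiv> ball 0 1"

(* Functions are total on the complex plane; only their values on the unit disc matter. *)
definition class_A :: "(complex \<Rightarrow> complex) set" where
  "class_A = {f. f holomorphic_on unit_disc \<and> f 0 = 0 \<and> deriv f 0 = 1}"

(* The value 1 at the origin fills in the removable singularity for f in class_A. *)
definition Q_ST :: "(complex \<Rightarrow> complex) \<Rightarrow> complex \<Rightarrow> complex" where
  "Q_ST f z = (if z = 0 then 1 else z * deriv f z / f z)"

definition Q_CV :: "(complex \<Rightarrow> complex) \<Rightarrow> complex \<Rightarrow> complex" where
  "Q_CV f z = 1 + z * deriv (deriv f) z / deriv f z"

definition schwarzian :: "(complex \<Rightarrow> complex) \<Rightarrow> complex \<Rightarrow> complex" where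
  "schwarzian f z =
     deriv (\<lambda>w. deriv (deriv f) w / deriv f w) z
     - 1/2 * (deriv (deriv f) z / deriv f z)^2"

definition Q_SD :: "(complex \<Rightarrow> complex) \<Rightarrow> complex \<Rightarrow> complex" where
  "Q_SD f z = z^2 * schwarzian f z"

(* Distinct from the constant starlike of HOL-Analysis, which is a property of sets.
   A zero of f in the disc other than the origin violates the condition, because
   x / 0 = 0 makes Q_ST vanish there. *)
definition starlike_function :: "(complex \<Rightarrow> complex) \<Rightarrow> bool" where
  "starlike_function f \<longleftrightarrow> f \<in> class_A \<and> (\<forall>z\<in>unit_disc. Re (Q_ST f z) > 0)"

end

theory Submission
  imports Defs
begin

text \<open>
  Write \<open>p\<close> for \<open>Q_ST f\<close>. It is holomorphic in the disc with \<open>p 0 = 1\<close>, and starlikeness says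
  that \<open>p\<close> stays in the right half-plane. If it does not, let \<open>z\<close> be a point of least modulus at
  which \<open>p\<close> reaches the imaginary axis, say \<open>p z = \<i> \<rho>\<close>. What happens at such a first point is
  the content of the Miller-Mocanu lemma:

  \<^item> \<open>Re p\<close> is minimal at \<open>z\<close> on the circle through \<open>z\<close>, so its first angular derivative vanishes
    and its second is nonnegative. Hence \<open>z p'(z)\<close> is a real number \<open>\<sigma>\<close>, and the real part of
    \<open>A = z p'(z) + z\<^sup>2 p''(z)\<close> is at most \<open>0\<close> (\<open>tangential_derivatives_at_minimum\<close>).
  \<^item> \<open>p\<close> maps the smaller disc bounded by that circle into the right half-plane, so the Schwarz lemma
    for the Cayley transform of \<open>p\<close> controls the radial derivative and gives
    \<open>\<sigma> \<le> - (1 + \<rho>\<^sup>2) / 2\<close> (\<open>radial_derivative_at_first_point\<close>).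

  Logarithmic differentiation expresses the other two quantities through \<open>p\<close>. First,
  \<open>Q_CV f = p + z p' / p\<close>, which at \<open>z\<close> equals \<open>\<i> \<kappa>\<close> with \<open>\<kappa> = \<rho> - \<sigma> / \<rho>\<close>: it is imaginary as
  well, and \<open>\<rho> \<kappa> = \<rho>\<^sup>2 - \<sigma> \<ge> 1/2\<close>. So of the three products \<open>Q_ST Q_CV\<close>, \<open>Q_ST\<^sup>2\<close>, \<open>Q_CV\<^sup>2\<close>
  the first is at most \<open>-1/2\<close> and the other two are nonpositive. Secondly, \<open>Q_SD f\<close> is
  \<open>z Q_CV' + (1 - Q_CV\<^sup>2) / 2\<close>; at \<open>z\<close> all its terms are real except the one coming from \<open>A\<close>,
  which makes its imaginary part equal to \<open>- Re A / \<rho>\<close>. Since \<open>\<rho>\<close> and \<open>\<kappa>\<close> have the same sign,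
  dividing \<open>Q_SD f\<close> by \<open>\<i> \<rho>\<close> or by \<open>\<i> \<kappa>\<close> gives a nonnegative real part
  (\<open>functionals_on_imaginary_axis\<close>). With \<open>\<alpha> \<le> 0 < \<beta>\<close> every one of the six inequalities is violated
  at \<open>z\<close>.
\<close>

section \<open>One-sided and second-order derivative tests\<close>

lemma second_derivative_nonneg_at_minimum:
  fixes u u' :: "real \<Rightarrow> real"
  assumes u: "\<And>x. (u has_real_derivative u' x) (at x)"
    and u': "(u' has_real_derivative D) (at a)"
    and min: "\<And>x. u a \<le> u x"
  shows "u' a = 0" "D \<ge> 0"
proof -
  show crit: "u' a = 0"
    using DERIV_local_min[OF u, of 1 a] min by simp
  show "D \<ge> 0"
  proof (rule ccontr)
    assume "\<not> D \<ge> 0"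
    then obtain d where d: "d > 0" "\<And>h. 0 < h \<Longrightarrow> h < d \<Longrightarrow> u' (a + h) < 0"
      using DERIV_neg_dec_right[OF u'] crit by force
    have "u a > u (a + d / 2)"
    proof (rule DERIV_neg_imp_decreasing_open[where f = u])
      show "a < a + d / 2" using d by simp
      show "\<exists>y. (u has_real_derivative y) (at x) \<and> y < 0" if "a < x" "x < a + d / 2" for x
        using u[of x] d(2)[of "x - a"] d(1) that by auto
      show "continuous_on {a..a + d / 2} u"
        using u by (meson DERIV_continuous_on has_field_derivative_at_within)
    qed
    then show False using min[of "a + d / 2"] by simp
  qed
qed

lemma derivative_nonneg_at_left_maximum:
  fixes g :: "real \<Rightarrow> real"
  assumes g: "(g has_real_derivative D) (at b)" and "a < b"
    and max: "\<And>t. a \<le> t \<Longrightarrow> t < b \<Longrightarrow> g t \<le> g b"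
  shows "D \<ge> 0"
proof (rule ccontr)
  assume "\<not> D \<ge> 0"
  then obtain d where d: "d > 0" "\<And>h. 0 < h \<Longrightarrow> h < d \<Longrightarrow> g b < g (b - h)"
    using DERIV_neg_dec_left[OF g] by force
  define h where "h = min (d / 2) (b - a)"
  have "0 < h" "h \<le> b - a" "h < d" using d(1) \<open>a < b\<close> by (auto simp: h_def)
  then show False
    using max[of "b - h"] d(2)[of h] by simp
qed

lemma has_real_derivative_Re_of_real:
  assumes "(F has_field_derivative D) (at (of_real x))"
  shows "((\<lambda>t. Re (F (of_real t))) has_real_derivative Re D) (at x)"
    and "((\<lambda>t. Im (F (of_real t))) has_real_derivative Im D) (at x)"
  using has_vector_derivative_real_field[OF assms, of UNIV]
    bounded_linear.has_vector_derivative[OF bounded_linear_Re]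
    bounded_linear.has_vector_derivative[OF bounded_linear_Im]
  unfolding has_real_derivative_iff_has_vector_derivative by blast+

section \<open>The first point on the imaginary axis\<close>

text \<open>
  A point of least modulus in the compact set \<open>{w. norm w \<le> norm z \<and> Re (p w) \<le> 0}\<close> works: below
  its modulus \<open>Re p\<close> is positive, and on its circle \<open>Re p \<ge> 0\<close> follows by continuity.
\<close>
lemma first_point_on_imaginary_axis:
  assumes cont: "continuous_on unit_disc p" and p0: "Re (p 0) > 0"
    and z: "z \<in> unit_disc" "Re (p z) \<le> 0"
  obtains z0 where "z0 \<in> unit_disc" "z0 \<noteq> 0" "Re (p z0) = 0"
    "\<And>w. norm w < norm z0 \<Longrightarrow> Re (p w) > 0"
    "\<And>w. norm w \<le> norm z0 \<Longrightarrow> Re (p w) \<ge> 0"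
proof -
  let ?K = "{w \<in> cball 0 (norm z). Re (p w) \<le> 0}"
  have contz: "continuous_on (cball 0 r) p" if "r < 1" for r
    using that by (intro continuous_on_subset[OF cont]) auto
  have "closed ?K"
    using z by (intro continuous_on_closed_Collect_le continuous_intros contz) auto
  moreover have "bounded ?K" by (rule bounded_subset[OF bounded_cball[of 0 "norm z"]]) auto
  ultimately have "compact ?K" by (simp add: compact_eq_bounded_closed)
  moreover have "z \<in> ?K" using z by simp
  ultimately obtain z0 where z0: "z0 \<in> ?K" "\<And>w. w \<in> ?K \<Longrightarrow> norm z0 \<le> norm w"
    using continuous_attains_inf[of ?K norm] by (auto intro: continuous_intros)
  have "norm z0 \<le> norm z" using z0(1) by simp
  then have z0_disc: "norm z0 < 1" using z by simp
  have "z0 \<noteq> 0" using z0(1) p0 by auto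
  have inside: "Re (p w) > 0" if "norm w < norm z0" for w
    using z0(2)[of w] z0(1) that by force
  have closed_disc: "Re (p w) \<ge> 0" if "norm w \<le> norm z0" for w
  proof -
    have "continuous_on (closure (ball 0 (norm z0))) (\<lambda>w. Re (p w))"
      using contz[OF z0_disc] \<open>z0 \<noteq> 0\<close> by (auto intro: continuous_intros)
    moreover have "w \<in> closure (ball 0 (norm z0))" using that \<open>z0 \<noteq> 0\<close> by simp
    ultimately show ?thesis
      by (rule continuous_ge_on_closure) (use inside in \<open>auto intro: less_imp_le\<close>)
  qed
  show thesis
    using that[of z0] z0(1) closed_disc[of z0] z0_disc \<open>z0 \<noteq> 0\<close> inside closed_disc by force
qed

text \<open>
  The second-order test for \<open>u x = Re (p (z * exp (\<i> * x)))\<close> at \<open>x = 0\<close>: the derivatives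
  are \<open>u' 0 = - Im (z p'(z))\<close> and \<open>u'' 0 = - Re (z p'(z) + z\<^sup>2 p''(z))\<close>.
\<close>
lemma tangential_derivatives_at_minimum:
  assumes holo: "p holomorphic_on unit_disc" and z: "z \<in> unit_disc"
    and min: "\<And>w. norm w = norm z \<Longrightarrow> Re (p z) \<le> Re (p w)"
  shows "Im (z * deriv p z) = 0"
    and "Re (z * deriv p z + z\<^sup>2 * deriv (deriv p) z) \<le> 0"
proof -
  have p': "(p has_field_derivative deriv p w) (at w)"
    and p'': "(deriv p has_field_derivative deriv (deriv p) w) (at w)"
    if "w \<in> unit_disc" for w
    using holo that by (auto intro!: holomorphic_derivI[of _ unit_disc] holomorphic_deriv)
  define c where "c t = z * exp (\<i> * t)" for t :: complex
  have c': "(c has_field_derivative \<i> * c t) (at t)" for t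
    unfolding c_def by (auto intro!: derivative_eq_intros)
  have norm_c: "norm (c (of_real x)) = norm z" for x :: real
    by (simp add: c_def norm_mult)
  then have c_disc: "c (of_real x) \<in> unit_disc" for x :: real
    using z by simp
  have c0: "c 0 = z" by (simp add: c_def)
  define u' where "u' x = Re (\<i> * c (of_real x) * deriv p (c (of_real x)))" for x :: real
  have u: "((\<lambda>x. Re (p (c (of_real x)))) has_real_derivative u' x) (at x)" for x
    unfolding u'_def
    by (rule has_real_derivative_Re_of_real)
       (use DERIV_chain2[OF p'[OF c_disc] c'] in \<open>simp add: mult_ac\<close>)
  have u'': "(u' has_real_derivative Re (- (z * deriv p z + z\<^sup>2 * deriv (deriv p) z))) (at 0)"
    unfolding u'_def
    by (rule has_real_derivative_Re_of_real)
       (use z in \<open>auto intro!: derivative_eq_intros c' DERIV_chain2[OF p'' c']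
          simp: c0 algebra_simps power2_eq_square\<close>)
  have "u' 0 = 0" "Re (- (z * deriv p z + z\<^sup>2 * deriv (deriv p) z)) \<ge> 0"
    by (rule second_derivative_nonneg_at_minimum[OF u u'']; use min norm_c c0 in simp)+
  then show "Im (z * deriv p z) = 0"
    "Re (z * deriv p z + z\<^sup>2 * deriv (deriv p) z) \<le> 0"
    by (auto simp: u'_def c0)
qed

text \<open>
  Clearing the denominator turns the bound on the Cayley transform into one that is polynomial in
  the real and imaginary parts, hence easy to differentiate.
\<close>
lemma norm_Cayley_le_iff:
  assumes "Re w > 0" "t \<ge> 0"
  shows "norm ((1 - w) / (1 + w)) \<le> t \<longleftrightarrow>
    (1 - t\<^sup>2) * (1 + (Re w)\<^sup>2 + (Im w)\<^sup>2) - 2 * (1 + t\<^sup>2) * Re w \<le> 0"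
proof -
  have "1 + w \<noteq> 0" using assms by (auto simp: complex_eq_iff)
  then have "norm ((1 - w) / (1 + w)) \<le> t \<longleftrightarrow> norm (1 - w) \<le> t * norm (1 + w)"
    by (simp add: norm_divide field_simps)
  also have "\<dots> \<longleftrightarrow> (norm (1 - w))\<^sup>2 \<le> t\<^sup>2 * (norm (1 + w))\<^sup>2"
    using assms by (metis power_mult_distrib power2_le_imp_le power_mono norm_ge_zero mult_nonneg_nonneg)
  finally show ?thesis
    by (simp add: cmod_power2) (simp add: power2_eq_square algebra_simps)
qed

text \<open>
  By the Schwarz lemma, \<open>norm ((1 - p) / (1 + p)) \<le> t\<close> at the point \<open>t z\<close> for \<open>0 \<le> t < 1\<close>. For
  \<open>t = 1\<close> both sides equal \<open>1\<close>, since \<open>p z\<close> is imaginary. The polynomial form \<open>g t \<le> 0\<close> of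
  this bound is therefore sharp at \<open>t = 1\<close>, and the claim is that \<open>g' 1 \<ge> 0\<close>.
\<close>
lemma radial_derivative_at_first_point:
  assumes holo: "p holomorphic_on unit_disc" and p0: "p 0 = 1"
    and z: "z \<in> unit_disc" "z \<noteq> 0" "Re (p z) = 0"
    and pos: "\<And>w. norm w < norm z \<Longrightarrow> Re (p w) > 0"
  shows "Re (z * deriv p z) \<le> - (1 + (Im (p z))\<^sup>2) / 2"
proof -
  define W where "W \<zeta> = (1 - p (z * \<zeta>)) / (1 + p (z * \<zeta>))" for \<zeta>
  have Re_pos: "Re (p (z * \<zeta>)) > 0" if "norm \<zeta> < 1" for \<zeta>
    using pos[of "z * \<zeta>"] z that by (simp add: norm_mult)
  have in_disc: "z * \<zeta> \<in> unit_disc" if "norm \<zeta> \<le> 1" for \<zeta>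
  proof -
    have "norm z * norm \<zeta> \<le> norm z" using that by (simp add: mult_left_le)
    also have "\<dots> < 1" using z by simp
    finally show ?thesis by (simp add: norm_mult)
  qed
  have "W holomorphic_on ball 0 1"
  proof -
    have "(p \<circ> (\<lambda>\<zeta>. z * \<zeta>)) holomorphic_on ball 0 1"
      by (rule holomorphic_on_compose_gen[OF _ holo]) (use in_disc in \<open>auto intro!: holomorphic_intros\<close>)
    moreover have "1 + p (z * \<zeta>) \<noteq> 0" if "norm \<zeta> < 1" for \<zeta>
      using Re_pos[OF that] by (auto simp: complex_eq_iff)
    ultimately show ?thesis
      unfolding W_def comp_def by (auto intro!: holomorphic_intros)
  qed
  moreover have "W 0 = 0" by (simp add: W_def p0)
  moreover have "norm (W \<zeta>) < 1" if "norm \<zeta> < 1" for \<zeta>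
  proof -
    have "norm (1 - p (z * \<zeta>)) < norm (1 + p (z * \<zeta>))"
    proof (rule power_less_imp_less_base)
      show "(norm (1 - p (z * \<zeta>)))\<^sup>2 < (norm (1 + p (z * \<zeta>)))\<^sup>2"
        using Re_pos[OF that] unfolding cmod_power2 by (simp add: power2_eq_square algebra_simps)
    qed simp
    then show ?thesis by (simp add: W_def norm_divide divide_less_eq)
  qed
  ultimately have schwarz: "norm (W \<zeta>) \<le> norm \<zeta>" if "norm \<zeta> < 1" for \<zeta>
    using Schwarz_Lemma(1)[of W \<zeta>] that by blast
  define P where "P t = Re (p (z * of_real t))" for t
  define Q where "Q t = Im (p (z * of_real t))" for t
  define g where "g t = (1 - t\<^sup>2) * (1 + (P t)\<^sup>2 + (Q t)\<^sup>2) - 2 * (1 + t\<^sup>2) * P t" for t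
  have "((\<lambda>\<zeta>. p (z * \<zeta>)) has_field_derivative deriv p z * z) (at (of_real 1))"
  proof (rule DERIV_chain2[where f = p and g = "(*) z"])
    show "(p has_field_derivative deriv p z) (at (z * of_real 1))"
      using holomorphic_derivI[OF holo open_ball z(1)] by simp
    show "((*) z has_field_derivative z) (at (of_real 1))"
      by (auto intro!: derivative_eq_intros)
  qed
  then have P': "(P has_real_derivative Re (deriv p z * z)) (at 1)"
    and Q': "(Q has_real_derivative Im (deriv p z * z)) (at 1)"
    unfolding P_def Q_def by (fact has_real_derivative_Re_of_real)+
  have P1: "P 1 = 0" and Q1: "Q 1 = Im (p z)" using z by (auto simp: P_def Q_def)
  have "(g has_real_derivative - 2 * (1 + (Im (p z))\<^sup>2) - 4 * Re (z * deriv p z)) (at 1)"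
    unfolding g_def by (auto intro!: derivative_eq_intros P' Q' simp: P1 Q1 algebra_simps)
  moreover have "g t \<le> g 1" if "0 \<le> t" "t < 1" for t
  proof -
    have "g t \<le> 0"
      using norm_Cayley_le_iff[OF Re_pos[of "of_real t"], of t] schwarz[of "of_real t"] that
      by (simp add: W_def g_def P_def Q_def)
    then show ?thesis by (simp add: g_def P1)
  qed
  ultimately have "- 2 * (1 + (Im (p z))\<^sup>2) - 4 * Re (z * deriv p z) \<ge> 0"
    by (rule derivative_nonneg_at_left_maximum[OF _ zero_less_one])
  then show ?thesis by simp
qed

section \<open>Convexity and Schwarzian quantities in terms of the starlikeness quantity\<close>

text \<open>
  Away from the origin \<open>Q_ST f\<close> is \<open>f'\<close> divided by \<open>h z = f z / z\<close>, and \<open>h\<close> extends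
  holomorphically to a function without zeros whose value at \<open>0\<close> is \<open>f' 0 = 1\<close>.
\<close>
lemma Q_ST_holomorphic:
  assumes f: "f holomorphic_on unit_disc" "f 0 = 0" "deriv f 0 = 1"
    and nz: "\<And>z. z \<in> unit_disc \<Longrightarrow> z \<noteq> 0 \<Longrightarrow> f z \<noteq> 0"
  shows "Q_ST f holomorphic_on unit_disc"
proof -
  define h where "h z = (if z = 0 then deriv f 0 else (f z - f 0) / (z - 0))" for z
  have "h holomorphic_on unit_disc"
    unfolding h_def using f(1) by (rule pole_lemma_open) simp
  moreover have "h z \<noteq> 0" if "z \<in> unit_disc" for z
    using that nz f by (auto simp: h_def)
  ultimately have "(\<lambda>z. deriv f z / h z) holomorphic_on unit_disc"
    using f(1) by (intro holomorphic_intros) auto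
  then show ?thesis
    by (rule holomorphic_transform) (use f in \<open>auto simp: Q_ST_def h_def\<close>)
qed

text \<open>
  The logarithmic derivative of \<open>p = z f' / f\<close> is \<open>p' / p = 1 / z + f'' / f' - p / z\<close>.
\<close>
lemma pre_schwarzian_via_Q_ST:
  assumes f: "f holomorphic_on unit_disc"
    and nz: "f z \<noteq> 0" "deriv f z \<noteq> 0" and z: "z \<in> unit_disc" "z \<noteq> 0"
  shows "deriv (deriv f) z / deriv f z = deriv (Q_ST f) z / Q_ST f z + (Q_ST f z - 1) / z"
proof -
  have "((\<lambda>w. w * deriv f w / f w) has_field_derivative
      ((deriv f z + z * deriv (deriv f) z) * f z - z * deriv f z * deriv f z) / (f z)\<^sup>2) (at z)"
    using f nz z by (auto intro!: derivative_eq_intros holomorphic_derivI[of _ unit_disc]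
      holomorphic_deriv simp: power2_eq_square algebra_simps)
  then have "(Q_ST f has_field_derivative
      ((deriv f z + z * deriv (deriv f) z) * f z - z * deriv f z * deriv f z) / (f z)\<^sup>2) (at z)"
    by (rule has_field_derivative_transform_within_open[of _ _ _ "- {0}"])
       (use z in \<open>auto simp: Q_ST_def\<close>)
  then have "deriv (Q_ST f) z =
      ((deriv f z + z * deriv (deriv f) z) * f z - z * deriv f z * deriv f z) / (f z)\<^sup>2"
    by (rule DERIV_imp_deriv)
  then show ?thesis
    using nz z by (simp add: Q_ST_def field_simps power2_eq_square)
qed

lemma Q_CV_via_Q_ST:
  assumes "f holomorphic_on unit_disc"
    and "f z \<noteq> 0" "deriv f z \<noteq> 0" "z \<in> unit_disc" "z \<noteq> 0"
  shows "Q_CV f z = Q_ST f z + z * deriv (Q_ST f) z / Q_ST f z"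
proof -
  have "Q_ST f z \<noteq> 0" using assms by (simp add: Q_ST_def)
  then show ?thesis
    using pre_schwarzian_via_Q_ST[OF assms] assms(5)
    unfolding Q_CV_def times_divide_eq_right[symmetric] by (simp add: field_simps)
qed

text \<open>
  The first bracket is \<open>z * deriv (Q_CV f) z\<close>, written out for \<open>Q_CV f = p + z p' / p\<close> with
  \<open>z p' + z\<^sup>2 p''\<close> kept together, because that is the combination whose sign the angular
  derivative test provides.
\<close>
lemma Q_SD_via_Q_ST:
  assumes f: "f holomorphic_on unit_disc" "f 0 = 0" "deriv f 0 = 1"
    and nz: "\<And>z. z \<in> unit_disc \<Longrightarrow> z \<noteq> 0 \<Longrightarrow> f z \<noteq> 0"
      "\<And>z. z \<in> unit_disc \<Longrightarrow> deriv f z \<noteq> 0"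
    and z: "z \<in> unit_disc" "z \<noteq> 0"
  defines "p \<equiv> Q_ST f"
  shows "Q_SD f z = (z * deriv p z + (z * deriv p z + z\<^sup>2 * deriv (deriv p) z) / p z
      - (z * deriv p z / p z)\<^sup>2) + (1 - (Q_CV f z)\<^sup>2) / 2"
proof -
  have holo: "p holomorphic_on unit_disc"
    unfolding p_def using Q_ST_holomorphic f nz by blast
  have pz: "p z \<noteq> 0" using z nz by (simp add: p_def Q_ST_def)
  define N where "N = (\<lambda>w. deriv (deriv f) w / deriv f w)"
  have N: "N w = deriv p w / p w + (p w - 1) / w" if "w \<in> unit_disc - {0}" for w
    unfolding N_def p_def using pre_schwarzian_via_Q_ST[OF f(1)] nz that by blast
  have "((\<lambda>w. deriv p w / p w + (p w - 1) / w) has_field_derivative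
      (deriv (deriv p) z * p z - deriv p z * deriv p z) / (p z * p z)
      + (deriv p z * z - (p z - 1)) / (z * z)) (at z)"
    using holo z pz by (auto intro!: derivative_eq_intros holomorphic_derivI[of _ unit_disc]
      holomorphic_deriv)
  then have "(N has_field_derivative
      (deriv (deriv p) z * p z - deriv p z * deriv p z) / (p z * p z)
      + (deriv p z * z - (p z - 1)) / (z * z)) (at z)"
    by (rule has_field_derivative_transform_within_open[of _ _ _ "unit_disc - {0}"])
       (use z N in auto)
  then have N': "deriv N z = (deriv (deriv p) z * p z - deriv p z * deriv p z) / (p z * p z)
      + (deriv p z * z - (p z - 1)) / (z * z)"
    by (rule DERIV_imp_deriv)
  have "Q_SD f z = z\<^sup>2 * deriv N z - (z * N z)\<^sup>2 / 2"
    by (simp add: Q_SD_def schwarzian_def N_def right_diff_distrib power_mult_distrib power_divide)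
  moreover have "z\<^sup>2 * deriv N z = z\<^sup>2 * deriv (deriv p) z / p z - (z * deriv p z / p z)\<^sup>2
      + z * deriv p z - (p z - 1)"
    unfolding N' using pz z by (simp add: field_simps power2_eq_square)
  moreover have "z * N z = Q_CV f z - 1" by (simp add: N_def Q_CV_def)
  moreover have "Q_CV f z = p z + z * deriv p z / p z"
    unfolding p_def using Q_CV_via_Q_ST[OF f(1)] nz z by blast
  ultimately show ?thesis
    by (simp add: add_divide_distrib diff_divide_distrib power2_diff)
qed

section \<open>Signs at the first point\<close>

text \<open>
  Here \<open>\<i> \<rho>\<close>, \<open>q\<close> and \<open>S\<close> are the values of \<open>Q_ST f\<close>, \<open>Q_CV f\<close> and \<open>Q_SD f\<close>, while \<open>\<sigma>\<close> is
  \<open>z p'\<close> and \<open>A\<close> is \<open>z p' + z\<^sup>2 p''\<close>. Both \<open>\<i> \<rho>\<close> and \<open>q\<close> are imaginary and point in the same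
  direction, and the only term of \<open>S\<close> that need not be real is
  \<open>A / (\<i> \<rho>)\<close>.
\<close>
lemma functionals_on_imaginary_axis:
  fixes \<rho> \<sigma> :: real and q s S A :: complex
  assumes rho: "\<rho> \<noteq> 0" and sigma: "\<sigma> \<le> - (1 + \<rho>\<^sup>2) / 2"
    and q: "q = \<i> * \<rho> + \<sigma> / (\<i> * \<rho>)"
    and S: "S = (of_real \<sigma> + A / (\<i> * \<rho>) - (\<sigma> / (\<i> * \<rho>))\<^sup>2) + (1 - q\<^sup>2) / 2"
    and A: "Re A \<le> 0"
  shows "Re (\<i> * \<rho> * q) \<le> - 1/2" "Re (q * q) \<le> 0" "Re ((\<i> * \<rho>) * (\<i> * \<rho>)) \<le> 0"
    "Re (S / (\<i> * \<rho>)) \<ge> 0" "Re (S / q) \<ge> 0"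
proof -
  define \<kappa> where "\<kappa> = \<rho> - \<sigma> / \<rho>"
  have q: "q = \<i> * \<kappa>"
    unfolding q \<kappa>_def using rho by (simp add: complex_eq_iff Re_divide Im_divide power2_eq_square)
  have kr: "\<rho> * \<kappa> = \<rho>\<^sup>2 - \<sigma>"
    using rho by (simp add: \<kappa>_def field_simps power2_eq_square)
  have kr_ge: "\<rho> * \<kappa> \<ge> 1/2"
  proof -
    have "- (1 + \<rho>\<^sup>2) / 2 \<le> - 1 / 2" by (simp add: divide_right_mono)
    with sigma have "\<sigma> \<le> - 1 / 2" by (rule order_trans)
    with zero_le_power2[of \<rho>] have "0 + 1 / 2 \<le> \<rho>\<^sup>2 + (- \<sigma>)"
      by (intro add_mono) auto
    then show ?thesis unfolding kr by simp
  qed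
  show "Re (\<i> * \<rho> * q) \<le> - 1/2" "Re (q * q) \<le> 0" "Re ((\<i> * \<rho>) * (\<i> * \<rho>)) \<le> 0"
    using kr_ge by (auto simp: q)
  have Im_S: "\<rho> * Im S = - Re A"
    using rho by (simp add: S q Re_divide Im_divide power2_eq_square)
  have "Re (S / (\<i> * \<rho>)) = \<rho> * Im S / \<rho>\<^sup>2"
    using rho by (simp add: Re_divide power2_eq_square)
  then show "Re (S / (\<i> * \<rho>)) \<ge> 0" using A Im_S by (simp add: divide_nonpos_nonneg)
  have "Re (S / q) = (\<rho> * Im S) / (\<rho> * \<kappa>)"
    using rho kr_ge by (auto simp: q Re_divide power2_eq_square)
  then show "Re (S / q) \<ge> 0" using A Im_S kr_ge by (simp add: divide_nonpos_nonneg)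
qed

theorem theorem2p18:
  fixes f :: "complex \<Rightarrow> complex" and \<alpha> \<beta> :: real
  assumes "\<alpha> \<le> 0" and "\<beta> > 0"
    and "f \<in> class_A"
    and "\<forall>z\<in>unit_disc. (if z = 0 then 1 else f z * deriv f z / z) \<noteq> 0"
    and "
      (\<forall>z\<in>unit_disc. Q_ST f z \<noteq> 0 \<and>
         Re (of_real \<alpha> * (Q_SD f z / Q_ST f z) + of_real \<beta> * (Q_ST f z * Q_CV f z)) > - \<beta> / 2) \<or>
      (\<forall>z\<in>unit_disc. Q_CV f z \<noteq> 0 \<and>
         Re (of_real \<alpha> * (Q_SD f z / Q_CV f z) + of_real \<beta> * (Q_ST f z * Q_CV f z)) > - \<beta> / 2) \<or>
      (\<forall>z\<in>unit_disc. Q_CV f z \<noteq> 0 \<and>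
         Re (of_real \<alpha> * (Q_SD f z / Q_CV f z) + of_real \<beta> * (Q_ST f z * Q_ST f z)) > 0) \<or>
      (\<forall>z\<in>unit_disc. Q_ST f z \<noteq> 0 \<and>
         Re (of_real \<alpha> * (Q_SD f z / Q_ST f z) + of_real \<beta> * (Q_CV f z * Q_CV f z)) > 0) \<or>
      (\<forall>z\<in>unit_disc. Q_ST f z \<noteq> 0 \<and>
         Re (of_real \<alpha> * (Q_SD f z / Q_ST f z) + of_real \<beta> * (Q_ST f z * Q_ST f z)) > 0) \<or>
      (\<forall>z\<in>unit_disc. Q_CV f z \<noteq> 0 \<and>
         Re (of_real \<alpha> * (Q_SD f z / Q_CV f z) + of_real \<beta> * (Q_CV f z * Q_CV f z)) > 0)"
  shows "starlike_function f"
proof (rule ccontr)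
  assume not_starlike: "\<not> starlike_function f"
  have f: "f holomorphic_on unit_disc" "f 0 = 0" "deriv f 0 = 1"
    using assms(3) by (auto simp: class_A_def)
  have nz: "f z \<noteq> 0" if "z \<in> unit_disc" "z \<noteq> 0" for z
    using assms(4) that by (metis div_0 mult_zero_left)
  have nz': "deriv f z \<noteq> 0" if "z \<in> unit_disc" for z
    using assms(4) that f(3) by (metis div_0 mult_zero_right zero_neq_one)
  define p where "p = Q_ST f"
  have holo: "p holomorphic_on unit_disc"
    unfolding p_def using f nz by (rule Q_ST_holomorphic)
  have p0: "p 0 = 1" by (simp add: p_def Q_ST_def)
  obtain z1 where "z1 \<in> unit_disc" "Re (p z1) \<le> 0"
    using not_starlike assms(3) by (force simp: starlike_function_def p_def not_less)
  then obtain z where z: "z \<in> unit_disc" "z \<noteq> 0" "Re (p z) = 0"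
    and pos: "\<And>w. norm w < norm z \<Longrightarrow> Re (p w) > 0"
    and nonneg: "\<And>w. norm w \<le> norm z \<Longrightarrow> Re (p w) \<ge> 0"
    using first_point_on_imaginary_axis[of p z1] holomorphic_on_imp_continuous_on[OF holo] p0 by auto
  define \<rho> \<sigma> where "\<rho> = Im (p z)" and "\<sigma> = Re (z * deriv p z)"
  define A where "A = z * deriv p z + z\<^sup>2 * deriv (deriv p) z"
  have "Im (z * deriv p z) = 0" and A: "Re A \<le> 0"
    unfolding A_def using tangential_derivatives_at_minimum[OF holo z(1)] nonneg z(3) by simp_all
  then have pz: "p z = \<i> * \<rho>" and zp': "z * deriv p z = of_real \<sigma>"
    using z(3) by (simp_all add: complex_eq_iff \<rho>_def \<sigma>_def)
  have "p z \<noteq> 0" using nz[OF z(1,2)] nz'[OF z(1)] z(2) by (simp add: p_def Q_ST_def)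
  then have rho: "\<rho> \<noteq> 0" by (simp add: pz)
  have sigma: "\<sigma> \<le> - (1 + \<rho>\<^sup>2) / 2"
    unfolding \<rho>_def \<sigma>_def using radial_derivative_at_first_point[OF holo p0 z] pos by blast
  have q: "Q_CV f z = \<i> * \<rho> + \<sigma> / (\<i> * \<rho>)"
    using Q_CV_via_Q_ST[OF f(1) nz[OF z(1,2)] nz'[OF z(1)] z(1,2)] pz zp' by (simp add: p_def)
  have S: "Q_SD f z = (of_real \<sigma> + A / (\<i> * \<rho>) - (\<sigma> / (\<i> * \<rho>))\<^sup>2) + (1 - (Q_CV f z)\<^sup>2) / 2"
    using Q_SD_via_Q_ST[OF f nz nz' z(1,2), folded p_def, folded A_def] pz zp' by simp
  note bv = functionals_on_imaginary_axis[OF rho sigma q S A, folded pz, unfolded p_def]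
  have combine: "Re (of_real \<alpha> * X + of_real \<beta> * Y) \<le> \<beta> * c"
    if "Re X \<ge> 0" "Re Y \<le> c" for X Y c
  proof -
    have "\<alpha> * Re X \<le> 0" using assms(1) that(1) by (rule mult_nonpos_nonneg)
    moreover have "\<beta> * Re Y \<le> \<beta> * c" using that(2) assms(2) by simp
    ultimately show ?thesis by simp
  qed
  have half: "\<not> Re (of_real \<alpha> * X + of_real \<beta> * Y) > - \<beta> / 2"
    if "Re X \<ge> 0" "Re Y \<le> - 1 / 2" for X Y
    using combine[OF that] by simp
  have zero: "\<not> Re (of_real \<alpha> * X + of_real \<beta> * Y) > 0"
    if "Re X \<ge> 0" "Re Y \<le> 0" for X Y
    using combine[OF that] by simp
  note absurd = half[OF bv(4,1)] half[OF bv(5,1)] zero[OF bv(5,3)]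
    zero[OF bv(4,2)] zero[OF bv(4,3)] zero[OF bv(5,2)]
  show False
    by (insert assms(5), elim disjE; drule bspec[OF _ z(1)]; use absurd in blast)
qed

end
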